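(* Let $S$ be an $h$-dimensional $\mathbb{F}_q$-subspace of $\mathbb{F}_{q^n}$ such that $1\in S$ and $3\le h\le n-2$. Let $a\in\mathbb{F}_{q^n}\setminus S$, $b\in\mathbb{F}_{q^n}\setminus\mathbb{F}_q$, and $U=(S\times\{0\})\oplus\langle(1,1)\rangle_{\mathbb{F}_q}\oplus\langle(a,b)\rangle_{\mathbb{F}_q}\subseteq\mathbb{F}_{q^n}^2$. Then the set of points of weight $2$ in $L_U$ different from $\langle(1,0)\rangle_{\mathbb{F}_{q^n}}$ is $\{P_s=\langle(-s+a,b)\rangle_{\mathbb{F}_{q^n}} : s\in S\cap(a+bS)\}$, and the size of this set is $|S\cap(a+bS)|$. In particular, $L_U$ is an $h$-club of rank $h+2$ if and only if $a\notin S+bS$.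
   Context: $q$ is a prime power and $n$ a positive integer. For an $\mathbb{F}_q$-subspace $U$ of $\mathbb{F}_{q^n}^2$, $L_U=\{\langle u\rangle_{\mathbb{F}_{q^n}}: u\in U\setminus\{0\}\}\subseteq\mathrm{PG}(1,q^n)$ is an $\mathbb{F}_q$-linear set of rank $\dim_{\mathbb{F}_q}U$; the weight of $P=\langle v\rangle_{\mathbb{F}_{q^n}}$ is $w_{L_U}(P)=\dim_{\mathbb{F}_q}(U\cap\langle v\rangle_{\mathbb{F}_{q^n}})$. An $i$-club of rank $k$ is an $\mathbb{F}_q$-linear set of rank $k$ in which exactly one point has weight $i$ and all other points have weight $1$. For $b\in\mathbb{F}_{q^n}$ and a subspace $S$, $bS=\{bs:s\in S\}$, $a+bS=\{a+bs: s\in S\}$, and $S+bS$ is the sum of subspaces. *)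

theory Defs
  imports
    "HOL-Library.Set_Algebras"
    "HOL-Library.Product_Plus"
    "HOL-Library.Cardinality"
    "HOL-Number_Theory.Prime_Powers"
begin

text \<open>
  The extension of the field with \<open>q\<close> elements by the field with \<open>q ^ n\<close> elements is given by a
  field homomorphism \<open>\<phi> :: 'k \<Rightarrow> 'a\<close> (necessarily injective); the subfield is \<open>range \<phi>\<close>.
  Subspaces, spans and dimensions over \<open>'k\<close> are then those of the locale \<^locale>\<open>vector_space\<close>.
\<close>

definition field_embedding :: "('k::field \<Rightarrow> 'a::field) \<Rightarrow> bool" where
  "field_embedding \<phi> \<longleftrightarrow>
     \<phi> 1 = 1 \<and> (\<forall>x y. \<phi> (x + y) = \<phi> x + \<phi> y) \<and> (\<forall>x y. \<phi> (x * y) = \<phi> x * \<phi> y)"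

definition scale1 :: "('k::field \<Rightarrow> 'a::field) \<Rightarrow> 'k \<Rightarrow> 'a \<Rightarrow> 'a" where
  "scale1 \<phi> c x = \<phi> c * x"

definition scale2 :: "('k::field \<Rightarrow> 'a::field) \<Rightarrow> 'k \<Rightarrow> 'a \<times> 'a \<Rightarrow> 'a \<times> 'a" where
  "scale2 \<phi> c v = (\<phi> c * fst v, \<phi> c * snd v)"

lemma vector_space_scale1: "field_embedding \<phi> \<Longrightarrow> vector_space (scale1 \<phi>)"
  by unfold_locales (auto simp: field_embedding_def scale1_def algebra_simps)

lemma vector_space_scale2: "field_embedding \<phi> \<Longrightarrow> vector_space (scale2 \<phi>)"
  by unfold_locales (auto simp: field_embedding_def scale2_def algebra_simps)

lemma field_embedding_id: "field_embedding id"
  by (simp add: field_embedding_def)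

text \<open>A point of the projective line over \<open>'a\<close> is the set of vectors of a one-dimensional
  \<open>'a\<close>-subspace of \<open>'a \<times> 'a\<close>.\<close>

definition point :: "'a::field \<times> 'a \<Rightarrow> ('a \<times> 'a) set" where
  "point v = module.span (scale2 id) {v}"

definition linear_set :: "('a::field \<times> 'a) set \<Rightarrow> ('a \<times> 'a) set set" where
  "linear_set U = {point u | u. u \<in> U - {0}}"

definition weight ::
  "('k::field \<Rightarrow> 'a::field) \<Rightarrow> ('a \<times> 'a) set \<Rightarrow> ('a \<times> 'a) set \<Rightarrow> nat" where
  "weight \<phi> U P = vector_space.dim (scale2 \<phi>) (U \<inter> P)"

text \<open>Rank and weights depend on the subspace \<open>U\<close> and not only on the point set
  \<open>linear_set U\<close>, so being a club is a property of \<open>U\<close>.\<close>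

definition is_club ::
  "('k::field \<Rightarrow> 'a::field) \<Rightarrow> nat \<Rightarrow> nat \<Rightarrow> ('a \<times> 'a) set \<Rightarrow> bool" where
  "is_club \<phi> i k U \<longleftrightarrow>
     module.subspace (scale2 \<phi>) U \<and>
     vector_space.dim (scale2 \<phi>) U = k \<and>
     (\<exists>!P. P \<in> linear_set U \<and> weight \<phi> U P = i) \<and>
     (\<forall>P\<in>linear_set U. weight \<phi> U P \<noteq> i \<longrightarrow> weight \<phi> U P = 1)"

end

theory Submission
  imports Defs
begin

text \<open>
  Since \<open>1 \<in> S\<close>, the subspace is \<open>U = {(s + y a, x + y b)}\<close> with \<open>s \<in> S\<close> and \<open>x, y\<close> in the
  small field; as \<open>1, b\<close> are independent, it has dimension \<open>h + 2\<close> and meets \<open>point (1, 0)\<close> in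
  \<open>S \<times> {0}\<close>. Any other point is \<open>point (m, 1)\<close>, whose weight is at most 2, with equality iff
  \<open>m \<in> S\<close> and \<open>m b - a \<in> S\<close>. Putting \<open>s = a - m b\<close> turns this condition into
  \<open>s \<in> S \<inter> (a + b S)\<close>, and this intersection is empty iff \<open>a \<notin> S + b S\<close>.
\<close>

section \<open>Linear algebra over the small field\<close>

locale finite_extension =
  fixes \<phi> :: "'k::field \<Rightarrow> 'a::{field,finite}"
  assumes embedding: "field_embedding \<phi>"
begin

lemma phi_simps [simp]:
  "\<phi> 1 = 1" "\<phi> (x + y) = \<phi> x + \<phi> y" "\<phi> (x * y) = \<phi> x * \<phi> y"
  using embedding by (auto simp: field_embedding_def)

lemma phi_0 [simp]: "\<phi> 0 = 0"
  by (metis add_0 add_cancel_right_right phi_simps(2))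

lemma phi_minus [simp]: "\<phi> (- x) = - \<phi> x"
  using phi_simps(2)[of x "- x"] by (simp add: eq_neg_iff_add_eq_0 add.commute)

sublocale V: vector_space "scale1 \<phi>"
  by (rule vector_space_scale1[OF embedding])

sublocale V2: vector_space "scale2 \<phi>"
  by (rule vector_space_scale2[OF embedding])

text \<open>Any basis serves here; extending the empty set produces one, and it is finite because
  the large field is.\<close>

sublocale V: finite_dimensional_vector_space "scale1 \<phi>" "V.extend_basis {}"
  by unfold_locales (auto simp: V.independent_extend_basis V.span_extend_basis V.independent_empty)

sublocale V2: finite_dimensional_vector_space "scale2 \<phi>" "V2.extend_basis {}"
  by unfold_locales
    (auto simp: V2.independent_extend_basis V2.span_extend_basis V2.independent_empty
          intro: finite_subset[OF subset_UNIV])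

sublocale V12: finite_dimensional_vector_space_pair
  "scale1 \<phi>" "V.extend_basis {}" "scale2 \<phi>" "V2.extend_basis {}" ..

sublocale V21: finite_dimensional_vector_space_pair
  "scale2 \<phi>" "V2.extend_basis {}" "scale1 \<phi>" "V.extend_basis {}" ..

end

section \<open>Points of the projective line and their normal forms\<close>

lemma mem_point_iff: "v \<in> point w \<longleftrightarrow> (\<exists>c. v = (c * fst w, c * snd w))"
proof -
  interpret vector_space "scale2 id :: 'a::field \<Rightarrow> _"
    by (rule vector_space_scale2[OF field_embedding_id])
  show ?thesis
    by (auto simp: point_def span_singleton scale2_def)
qed

lemma mem_point_self: "v \<in> point v"
  by (auto simp: mem_point_iff intro: exI[of _ 1])

lemma point_scale:
  assumes "c \<noteq> 0"
  shows "point (c * x, c * y) = point (x, y)"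
proof -
  have "(\<exists>d. v = (d * (c * x), d * (c * y))) \<longleftrightarrow> (\<exists>d. v = (d * x, d * y))" for v
  proof safe
    fix d
    show "\<exists>e. (d * x, d * y) = (e * (c * x), e * (c * y))"
      by (rule exI[of _ "d / c"]) (use assms in simp)
  qed (metis mult.assoc)
  then show ?thesis
    by (auto simp: mem_point_iff)
qed

lemma point_eq_infinity:
  assumes "x \<noteq> 0"
  shows "point (x, 0) = point (1, 0)"
  using point_scale[OF assms, of 1 0] by simp

lemma point_eq_affine:
  assumes "y \<noteq> 0"
  shows "point (x, y) = point (x / y, 1)"
  using point_scale[OF assms, of "x / y" 1] assms by simp

lemma point_affine_inject: "point (m, 1) = point (m', 1) \<longleftrightarrow> m = m'"
proof
  assume "point (m, 1) = point (m', 1)"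
  then have "(m, 1) \<in> point (m', 1)"
    using mem_point_self[of "(m, 1)"] by simp
  then show "m = m'"
    by (auto simp: mem_point_iff)
qed simp

lemma point_affine_neq_infinity: "point (m, 1) \<noteq> point (1, 0)"
proof
  assume "point (m, 1) = point (1, 0)"
  then have "(m, 1) \<in> point (1, 0)"
    using mem_point_self[of "(m, 1)"] by simp
  then show False
    by (simp add: mem_point_iff)
qed

section \<open>Coordinates on the subspace \<open>U\<close>\<close>

locale club_construction = finite_extension \<phi>
  for \<phi> :: "'k::field \<Rightarrow> 'a::{field,finite}" +
  fixes S :: "'a set" and a b :: 'a
  assumes subspace_S: "V.subspace S"
    and one_in_S: "1 \<in> S"
    and b_notin: "b \<notin> range \<phi>"
begin

definition U :: "('a \<times> 'a) set" where
  "U = (S \<times> {0}) + V2.span {(1, 1)} + V2.span {(a, b)}"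

lemma phi_mult_in_S: "s \<in> S \<Longrightarrow> \<phi> c * s \<in> S"
  using V.subspace_scale[OF subspace_S] by (simp add: scale1_def)

lemma phi_in_S: "\<phi> c \<in> S"
  using phi_mult_in_S[OF one_in_S] by simp

lemmas S_closed = V.subspace_add[OF subspace_S] V.subspace_diff[OF subspace_S]
  V.subspace_neg[OF subspace_S] V.subspace_0[OF subspace_S] phi_mult_in_S phi_in_S

text \<open>If \<open>y\<close> were nonzero, dividing the relation by \<open>\<phi> y\<close> would
  put \<open>b\<close> into the small field; once \<open>y = 0\<close>, a nonzero \<open>x\<close>
  would have an invertible image.\<close>

lemma one_b_independent: "\<phi> x + \<phi> y * b = 0 \<longleftrightarrow> x = 0 \<and> y = 0"
proof
  assume eq: "\<phi> x + \<phi> y * b = 0"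
  have "y = 0"
  proof (rule ccontr)
    assume "y \<noteq> 0"
    then have "\<phi> (inverse y) * \<phi> y = 1"
      by (metis phi_simps(1,3) left_inverse)
    moreover have "\<phi> y * b = - \<phi> x"
      using eq by (simp add: eq_neg_iff_add_eq_0 add.commute)
    ultimately have "b = \<phi> (inverse y * - x)"
      by (metis mult.assoc mult_1 phi_minus phi_simps(3))
    with b_notin show False
      by blast
  qed
  moreover have "x = 0"
  proof (rule ccontr)
    assume "x \<noteq> 0"
    then have "\<phi> x * \<phi> (inverse x) = 1"
      by (metis phi_simps(1,3) right_inverse)
    with eq \<open>y = 0\<close> show False
      by simp
  qed
  ultimately show "x = 0 \<and> y = 0"
    by simp
qed simp

lemma b_neq_0: "b \<noteq> 0"
  using one_b_independent[of 0 1] by auto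

text \<open>The multiple \<open>(\<phi> x, \<phi> x)\<close> of \<open>(1, 1)\<close> has its first
  coordinate in \<open>S\<close>, because \<open>1 \<in> S\<close>; so \<open>s\<close> absorbs it
  and \<open>x\<close> survives only in the second coordinate.\<close>

lemma mem_U_iff: "v \<in> U \<longleftrightarrow> (\<exists>s\<in>S. \<exists>x y. v = (s + \<phi> y * a, \<phi> x + \<phi> y * b))"
proof
  assume "v \<in> U"
  then obtain s x y where "s \<in> S" "v = ((s + \<phi> x) + \<phi> y * a, \<phi> x + \<phi> y * b)"
    by (auto simp: U_def set_plus_def V2.span_singleton scale2_def)
  then show "\<exists>s\<in>S. \<exists>x y. v = (s + \<phi> y * a, \<phi> x + \<phi> y * b)"
    using S_closed(1)[OF _ phi_in_S] by blast
next
  assume "\<exists>s\<in>S. \<exists>x y. v = (s + \<phi> y * a, \<phi> x + \<phi> y * b)"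
  then obtain s x y where s: "s \<in> S" and v: "v = (s + \<phi> y * a, \<phi> x + \<phi> y * b)"
    by blast
  \<comment> \<open>Subtracting \<open>\<phi> x\<close> from \<open>s\<close> compensates for the
    first coordinate of the multiple of \<open>(1, 1)\<close>.\<close>
  have "(s - \<phi> x, 0) + (\<phi> x, \<phi> x) + (\<phi> y * a, \<phi> y * b) \<in> U"
    unfolding U_def using s
    by (intro set_plus_intro) (auto simp: V2.span_singleton scale2_def S_closed)
  then show "v \<in> U"
    by (simp add: v)
qed

section \<open>The dimension of \<open>U\<close>\<close>

lemma subspace_S0: "V2.subspace (S \<times> {0})"
  by (auto simp: V2.subspace_def scale2_def S_closed zero_prod_def)

text \<open>Modulo \<open>S \<times> {0}\<close> the vector \<open>(1, 1)\<close> may be replaced by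
  \<open>(0, 1)\<close>. Adjoining the generators one at a time lets the dimension be counted step
  by step.\<close>

lemma U_eq_span: "U = V2.span (insert (a, b) (insert (0, 1) (S \<times> {0})))"
proof -
  have span_S0: "V2.span (S \<times> {0}) = S \<times> {0}"
    using subspace_S0 by simp
  have "v \<in> V2.span (insert (a, b) (insert (0, 1) (S \<times> {0}))) \<longleftrightarrow>
      (\<exists>y x. fst v - \<phi> y * a \<in> S \<and> snd v = \<phi> x + \<phi> y * b)" for v
    by (cases v) (auto simp: V2.span_insert span_S0 scale2_def algebra_simps)
  moreover have "v \<in> U \<longleftrightarrow> (\<exists>y x. fst v - \<phi> y * a \<in> S \<and> snd v = \<phi> x + \<phi> y * b)" for v
    by (cases v) (force simp: mem_U_iff)
  ultimately show ?thesis
    by blast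
qed

lemma subspace_U: "V2.subspace U"
  by (simp add: U_eq_span)

lemma dim_S0: "V2.dim (S \<times> {0}) = V.dim S"
proof -
  have "Vector_Spaces.linear (scale1 \<phi>) (scale2 \<phi>) (\<lambda>s. (s, 0))"
    by unfold_locales (auto simp: scale1_def scale2_def)
  then have "V2.dim ((\<lambda>s. (s, 0)) ` S) = V.dim S"
    by (rule V12.dim_image_eq) (auto simp: inj_on_def)
  moreover have "(\<lambda>s. (s, 0 :: 'a)) ` S = S \<times> {0}"
    by auto
  ultimately show ?thesis
    by simp
qed

lemma dim_U: "V2.dim U = V.dim S + 2"
proof -
  have span_S0: "V2.span (S \<times> {0}) = S \<times> {0}"
    using subspace_S0 by simp
  \<comment> \<open>Second coordinates show that each new generator is independent: they vanish on
    \<open>S \<times> {0}\<close>, and after adjoining \<open>(0, 1)\<close> they lie in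
    \<open>range \<phi>\<close>, which misses \<open>b\<close>.\<close>
  have "(0, 1) \<notin> V2.span (S \<times> {0})"
    unfolding span_S0 by simp
  moreover have "(a, b) \<notin> V2.span (insert (0, 1) (S \<times> {0}))"
    using b_notin by (auto simp: V2.span_insert span_S0 scale2_def)
  ultimately show ?thesis
    by (simp add: U_eq_span V2.dim_insert dim_S0)
qed

section \<open>Weights of the points\<close>

lemma weight_infinity: "weight \<phi> U (point (1, 0)) = V.dim S"
proof -
  \<comment> \<open>A vanishing second coordinate forces \<open>x = y = 0\<close> by independence of
    \<open>1\<close> and \<open>b\<close>.\<close>
  have "U \<inter> point (1, 0) = S \<times> {0}"
    by (auto simp: mem_U_iff mem_point_iff one_b_independent)
  then show ?thesis
    by (simp add: weight_def dim_S0)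
qed

text \<open>The second coordinate embeds \<open>U \<inter> point (m, 1)\<close> into the span of \<open>1\<close> and \<open>b\<close>,
  so the weight is at most 2, with equality iff both \<open>1\<close> and \<open>b\<close> are attained.\<close>

lemma
  shows weight_affine_le: "weight \<phi> U (point (m, 1)) \<le> 2"
    and weight_affine_eq_2_iff: "weight \<phi> U (point (m, 1)) = 2 \<longleftrightarrow> m \<in> S \<and> m * b - a \<in> S"
proof -
  define W where "W = U \<inter> point (m, 1)"
  define T where "T = snd ` W"
  have "V2.subspace (point (m, 1))"
    by (auto simp: V2.subspace_def mem_point_iff scale2_def zero_prod_def
        simp flip: distrib_right mult.assoc intro: exI[of _ 0])
  then have W: "V2.subspace W"
    unfolding W_def by (intro V2.subspace_inter subspace_U)
  have lin: "Vector_Spaces.linear (scale2 \<phi>) (scale1 \<phi>) snd"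
    by unfold_locales (auto simp: scale1_def scale2_def)
  \<comment> \<open>On \<open>point (m, 1)\<close> the first coordinate is \<open>m\<close> times
    the second.\<close>
  have "inj_on snd W"
    by (auto simp: inj_on_def W_def mem_point_iff)
  then have dim_T: "V.dim T = V2.dim W"
    unfolding T_def using V21.dim_image_eq[OF lin, of W] W by (metis V2.span_eq_iff)
  have T: "V.subspace T"
    unfolding T_def using lin W by (metis Vector_Spaces.linear.axioms(3) module_hom.subspace_image)
  have T_iff: "t \<in> T \<longleftrightarrow> (\<exists>x y. t = \<phi> x + \<phi> y * b \<and> m * t - \<phi> y * a \<in> S)" for t
  proof
    assume "t \<in> T"
    then show "\<exists>x y. t = \<phi> x + \<phi> y * b \<and> m * t - \<phi> y * a \<in> S"
      by (force simp: T_def W_def mem_U_iff mem_point_iff mult.commute)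
  next
    assume "\<exists>x y. t = \<phi> x + \<phi> y * b \<and> m * t - \<phi> y * a \<in> S"
    then obtain x y where t: "t = \<phi> x + \<phi> y * b" and s: "m * t - \<phi> y * a \<in> S"
      by blast
    have "(t * m, t) = ((m * t - \<phi> y * a) + \<phi> y * a, \<phi> x + \<phi> y * b)"
      by (simp add: t mult.commute)
    with s have "(t * m, t) \<in> U"
      unfolding mem_U_iff by blast
    then have "(t * m, t) \<in> W"
      by (simp add: W_def mem_point_iff)
    then show "t \<in> T"
      unfolding T_def by force
  qed
  have span_iff: "t \<in> V.span {1, b} \<longleftrightarrow> (\<exists>x y. t = \<phi> x + \<phi> y * b)" for t
    by (auto simp: V.span_insert scale1_def algebra_simps)
  have "b \<notin> V.span {}"
    using b_neq_0 by simp
  moreover have "1 \<notin> V.span {b}"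
  proof
    assume "1 \<in> V.span {b}"
    then obtain y where "\<phi> 1 + \<phi> (- y) * b = 0"
      by (auto simp: V.span_singleton scale1_def)
    then show False
      unfolding one_b_independent by simp
  qed
  ultimately have dim_1b: "V.dim (V.span {1, b}) = 2"
    by (simp add: V.dim_insert)
  have T_sub: "T \<subseteq> V.span {1, b}"
    using T_iff span_iff by blast
  show "weight \<phi> U (point (m, 1)) \<le> 2"
    using V.dim_subset[OF T_sub] dim_1b dim_T by (simp add: weight_def W_def)
  \<comment> \<open>Coefficients with respect to \<open>1\<close> and \<open>b\<close> are unique,
    so membership in \<open>T\<close> can be tested on the given \<open>x\<close> and
    \<open>y\<close> without an existential.\<close>
  have coords: "x = x' \<and> y = y'" if "\<phi> x + \<phi> y * b = \<phi> x' + \<phi> y' * b" for x y x' y'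
  proof -
    have "\<phi> (x + - x') + \<phi> (y + - y') * b = 0"
      using that by (simp only: phi_simps phi_minus) (simp add: algebra_simps)
    then show ?thesis
      unfolding one_b_independent by simp
  qed
  have T_coords: "\<phi> x + \<phi> y * b \<in> T \<longleftrightarrow> m * (\<phi> x + \<phi> y * b) - \<phi> y * a \<in> S" for x y
    unfolding T_iff by (metis coords)
  have "1 \<in> T \<longleftrightarrow> m \<in> S"
    using T_coords[of 1 0] by simp
  moreover have "b \<in> T \<longleftrightarrow> m * b - a \<in> S"
    using T_coords[of 0 1] by simp
  \<comment> \<open>\<open>T\<close> lies in a two-dimensional span, so it has dimension 2 exactly
    when it is the whole span, that is, when it contains both generators.\<close>
  moreover have "V.dim T = 2 \<longleftrightarrow> 1 \<in> T \<and> b \<in> T"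
  proof
    assume "V.dim T = 2"
    then have "T = V.span {1, b}"
      using V.subspace_dim_equal[OF T _ T_sub] dim_1b by simp
    then show "1 \<in> T \<and> b \<in> T"
      by (simp add: V.span_base)
  next
    assume "1 \<in> T \<and> b \<in> T"
    then have "V.span {1, b} \<subseteq> T"
      by (intro V.span_minimal T) auto
    with T_sub dim_1b show "V.dim T = 2"
      by simp
  qed
  ultimately show "weight \<phi> U (point (m, 1)) = 2 \<longleftrightarrow> m \<in> S \<and> m * b - a \<in> S"
    using dim_T by (simp add: weight_def W_def)
qed

lemma weight_pos:
  assumes "P \<in> linear_set U"
  shows "weight \<phi> U P > 0"
proof -
  obtain u where "u \<in> U" "u \<noteq> 0" "P = point u"
    using assms by (auto simp: linear_set_def)
  then have "\<not> U \<inter> P \<subseteq> {0}"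
    using mem_point_self[of u] by blast
  then show ?thesis
    using V2.dim_eq_0 by (auto simp: weight_def)
qed

lemma linear_set_cases:
  assumes "P \<in> linear_set U"
  obtains "P = point (1, 0)" | m where "P = point (m, 1)"
proof -
  obtain x y where "(x, y) \<noteq> 0" "P = point (x, y)"
    using assms by (auto simp: linear_set_def)
  then show thesis
    using that point_eq_infinity[of x] point_eq_affine[of y x]
    by (cases "y = 0") (auto simp: zero_prod_def)
qed

lemma point_infinity_in_linear_set: "point (1, 0) \<in> linear_set U"
proof -
  have "(1, 0) \<in> U"
    using one_in_S by (force simp: mem_U_iff intro: exI[of _ 0])
  then show ?thesis
    by (force simp: linear_set_def zero_prod_def)
qed

text \<open>A positive weight provides a nonzero vector of \<open>U\<close> on the point, and this
  vector generates the point.\<close>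

lemma in_linear_set_if_weight_pos:
  assumes "weight \<phi> U (point (m, 1)) > 0"
  shows "point (m, 1) \<in> linear_set U"
proof -
  have "\<not> U \<inter> point (m, 1) \<subseteq> {0}"
    using assms unfolding weight_def by (metis V2.dim_eq_0 less_irrefl)
  then obtain u where u: "u \<in> U" "u \<noteq> 0" "u \<in> point (m, 1)"
    by blast
  then obtain c where c: "u = (c * m, c * 1)"
    by (auto simp: mem_point_iff)
  with u have "c \<noteq> 0"
    by (auto simp: zero_prod_def)
  then have "point u = point (m, 1)"
    unfolding c by (rule point_scale)
  with u show ?thesis
    unfolding linear_set_def by blast
qed

section \<open>Points of weight 2 and the club criterion\<close>

lemma weight_2_points:
  "{P \<in> linear_set U. weight \<phi> U P = 2 \<and> P \<noteq> point (1, 0)} =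
     (\<lambda>s. point (- s + a, b)) ` (S \<inter> (a +o (b *o S)))"
  (is "?L = ?R")
proof (intro equalityI subsetI)
  fix P assume P: "P \<in> ?L"
  obtain m where m: "P = point (m, 1)" "m \<in> S" "m * b - a \<in> S"
  proof -
    have "P \<in> linear_set U"
      using P by simp
    then show thesis
      using P that by (cases rule: linear_set_cases) (auto simp: weight_affine_eq_2_iff)
  qed
  \<comment> \<open>This \<open>s\<close> solves \<open>m = (- s + a) / b\<close>, so that
    \<open>(m, 1)\<close> and \<open>(- s + a, b)\<close> are proportional.\<close>
  define s where "s = a - m * b"
  have "s \<in> S"
    using V.subspace_neg[OF subspace_S m(3)] by (simp add: s_def)
  moreover have "s = a + b * - m"
    by (simp add: s_def)
  then have "s \<in> a +o (b *o S)"
    using S_closed(3)[OF m(2)] unfolding elt_set_plus_def elt_set_times_def by blast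
  moreover have "P = point (- s + a, b)"
    using b_neq_0 point_eq_affine[of b "- s + a"] by (simp add: m(1) s_def)
  ultimately show "P \<in> ?R"
    by blast
next
  fix P assume "P \<in> ?R"
  then obtain s t where s: "s \<in> S" "t \<in> S" "s = a + b * t" "P = point (- s + a, b)"
    by (auto simp: elt_set_plus_def elt_set_times_def)
  \<comment> \<open>Here \<open>- s + a = - b * t\<close>, so dividing by \<open>b\<close> gives the
    slope \<open>- t\<close>; the two weight conditions then read \<open>- t \<in> S\<close> and
    \<open>- s \<in> S\<close>.\<close>
  have P: "P = point (- t, 1)"
    using b_neq_0 point_eq_affine[of b "- s + a"] by (simp add: s(3,4))
  have "- t * b - a = - s"
    by (simp add: s(3))
  then have "weight \<phi> U P = 2"
    unfolding P weight_affine_eq_2_iff using s(1,2) by (simp only: S_closed simp_thms)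
  then show "P \<in> ?L"
    using in_linear_set_if_weight_pos[of "- t"] point_affine_neq_infinity[of "- t"]
    by (simp add: P)
qed

text \<open>The slope \<open>(- s + a) / b\<close> determines \<open>s\<close>; this turns the
  parametrization of the weight 2 points into a count.\<close>

lemma inj_weight_2_points: "inj (\<lambda>s. point (- s + a, b))"
proof (rule injI)
  fix s s'
  assume "point (- s + a, b) = point (- s' + a, b)"
  then have "(- s + a) / b = (- s' + a) / b"
    unfolding point_eq_affine[OF b_neq_0] point_affine_inject .
  then show "s = s'"
    using b_neq_0 by simp
qed

text \<open>An equation \<open>s = a + b * t\<close> is the same as \<open>a = s + b * - t\<close>,
  and \<open>S\<close> is closed under negation.\<close>

lemma coset_inter_empty_iff: "S \<inter> (a +o (b *o S)) = {} \<longleftrightarrow> a \<notin> S + (b *o S)"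
proof -
  have "a \<in> S + (b *o S) \<longleftrightarrow> (\<exists>s\<in>S. \<exists>t\<in>S. a = s + b * t)"
    by (auto simp: elt_set_times_def set_plus_def)
  also have "\<dots> \<longleftrightarrow> (\<exists>s\<in>S. \<exists>t\<in>S. a = s + b * - t)"
    by (metis S_closed(3) minus_minus)
  also have "\<dots> \<longleftrightarrow> (\<exists>s\<in>S. \<exists>t\<in>S. s = a + b * t)"
    by (auto simp: algebra_simps)
  also have "\<dots> \<longleftrightarrow> S \<inter> (a +o (b *o S)) \<noteq> {}"
    by (auto simp: elt_set_plus_def elt_set_times_def)
  finally show ?thesis
    by blast
qed

lemma is_club_iff:
  assumes "V.dim S \<ge> 3"
  shows "is_club \<phi> (V.dim S) (V.dim S + 2) U \<longleftrightarrow> a \<notin> S + (b *o S)"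
proof -
  have w_le: "weight \<phi> U P \<le> 2" if "P \<in> linear_set U" "P \<noteq> point (1, 0)" for P
    using that by (cases rule: linear_set_cases) (simp_all add: weight_affine_le)
  \<comment> \<open>All points other than \<open>point (1, 0)\<close> have weight at most 2, below
    \<open>V.dim S \<ge> 3\<close>, so none of them can be a second point of that weight.\<close>
  have "P \<in> linear_set U \<and> weight \<phi> U P = V.dim S \<longleftrightarrow> P = point (1, 0)" for P
    using w_le[of P] assms weight_infinity point_infinity_in_linear_set by fastforce
  then have "is_club \<phi> (V.dim S) (V.dim S + 2) U \<longleftrightarrow>
      (\<forall>P\<in>linear_set U. P \<noteq> point (1, 0) \<longrightarrow> weight \<phi> U P = 1)"
    using subspace_U dim_U by (auto simp: is_club_def)
  also have "\<dots> \<longleftrightarrow> {P \<in> linear_set U. weight \<phi> U P = 2 \<and> P \<noteq> point (1, 0)} = {}"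
  proof -
    \<comment> \<open>The weight is positive and at most 2, which leaves only 1 and 2.\<close>
    have "weight \<phi> U P = 1 \<longleftrightarrow> weight \<phi> U P \<noteq> 2"
      if "P \<in> linear_set U" "P \<noteq> point (1, 0)" for P
      using w_le[OF that] weight_pos[OF that(1)] by linarith
    then show ?thesis
      by blast
  qed
  also have "\<dots> \<longleftrightarrow> a \<notin> S + (b *o S)"
    by (simp add: weight_2_points coset_inter_empty_iff)
  finally show ?thesis .
qed

end

theorem theorem3p2:
  fixes \<phi> :: "'k::{field,finite} \<Rightarrow> 'a::{field,finite}"
    and q n h :: nat
    and S :: "'a set"
    and a b :: 'a
    and U :: "('a \<times> 'a) set"
  assumes "primepow q" and "n > 0"
    and "CARD('k) = q" and "CARD('a) = q ^ n"
    and "field_embedding \<phi>"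
    and "module.subspace (scale1 \<phi>) S"
    and "vector_space.dim (scale1 \<phi>) S = h"
    and "1 \<in> S"
    and "3 \<le> h" and "h + 2 \<le> n"
    and "a \<notin> S"
    and "b \<notin> range \<phi>"
    and "U = (S \<times> {0}) + module.span (scale2 \<phi>) {(1, 1)} + module.span (scale2 \<phi>) {(a, b)}"
  shows "{P \<in> linear_set U. weight \<phi> U P = 2 \<and> P \<noteq> point (1, 0)} =
           {point (- s + a, b) | s. s \<in> S \<inter> (a +o (b *o S))} \<and>
         card {P \<in> linear_set U. weight \<phi> U P = 2 \<and> P \<noteq> point (1, 0)} =
           card (S \<inter> (a +o (b *o S))) \<and>
         (is_club \<phi> h (h + 2) U \<longleftrightarrow> a \<notin> S + (b *o S))"
proof -
  interpret club_construction \<phi> S a b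
    using assms(5,6,8,12)
    by (simp add: club_construction_def club_construction_axioms_def finite_extension_def)
  have U: "U = club_construction.U \<phi> S a b"
    unfolding U_def by (fact assms(13))
  have "(\<lambda>s. point (- s + a, b)) ` (S \<inter> (a +o (b *o S))) =
      {point (- s + a, b) | s. s \<in> S \<inter> (a +o (b *o S))}"
    by blast
  moreover have "card ((\<lambda>s. point (- s + a, b)) ` (S \<inter> (a +o (b *o S)))) =
      card (S \<inter> (a +o (b *o S)))"
    by (rule card_image[OF inj_on_subset[OF inj_weight_2_points subset_UNIV]])
  moreover have "is_club \<phi> h (h + 2) U \<longleftrightarrow> a \<notin> S + (b *o S)"
    using is_club_iff assms(7,9) unfolding U by blast
  ultimately show ?thesis
    unfolding U weight_2_points by metis
qed

end
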